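(* Let $\alpha>0$, $A\ge0$, $B>0$, $t>0$, and let $P_n(x,t)$ be the monic polynomials orthogonal on $[0,\infty)$ w.r.t. $w(x,t)=x^\alpha e^{-x}(A+B\theta(x-t))$, with recurrence $zP_n=P_{n+1}+\alpha_n(t)P_n+\beta_n(t)P_{n-1}$. Let $D_n(t)=\det\left(\int_0^\infty x^{i+j}w(x,t)dx\right)_{i,j=0}^{n-1}$ ($D_0=1$) and $H_n(t)=t\frac{d}{dt}\ln D_n(t)$. Then for $n\ge1$ (whenever denominators are nonzero) $$\alpha_n(t)-(2n+\alpha+1)=\frac{t^2H_n''+[(2n+\alpha)t-t^2]H_n'+tH_n}{2[H_n-n(n+\alpha)-tH_n']},\qquad \beta_n(t)-n(n+\alpha)=tH_n'-H_n,$$ where $H_n$ satisfies $$(tH_n'')^2=4(H_n')^2[H_n-n(n+\alpha)-tH_n']+[(2n+\alpha-t)H_n'+H_n]^2;$$ moreover $$\alpha_n(t)-(2n+\alpha+1)=H_n-H_{n+1},\qquad \beta_n(t)-n(n+\alpha)=\frac{H_n(2n+\alpha)-n(n+\alpha)(H_{n+1}-H_{n-1})}{t+H_{n+1}-H_{n-1}-2n-\alpha},$$ and $H_n$ satisfies the difference equation $$\left\{\frac{[H_n-n(n+\alpha)](t+H_{n+1}-H_{n-1})+t\,n(n+\alpha)}{t+H_{n+1}-H_{n-1}-2n-\alpha}\right\}^2=\left\{\frac{(2n+\alpha)[H_n-n(n+\alpha)]+t\,n(n+\alpha)}{t+H_{n+1}-H_{n-1}-2n-\alpha}\right\}(H_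n-H_{n+1})(H_{n-1}-H_n).$$
   Context: $\theta$ is the Heaviside function ($1$ for $x>0$, $0$ otherwise); primes denote $d/dt$. *)

theory Defs
  imports "HOL-Analysis.Analysis" "HOL-Computational_Algebra.Polynomial" "Jordan_Normal_Form.Determinant"
begin

definition lw :: "real \<Rightarrow> real \<Rightarrow> real \<Rightarrow> real \<Rightarrow> real \<Rightarrow> real" where
  "lw a A B t x = x powr a * exp (- x) * (A + B * (if x - t > 0 then 1 else 0))"

definition moment :: "real \<Rightarrow> real \<Rightarrow> real \<Rightarrow> real \<Rightarrow> nat \<Rightarrow> real" where
  "moment a A B t k = integral {0..} (\<lambda>x. x ^ k * lw a A B t x)"

text \<open>Hankel determinant D_n(t) (the 0 x 0 determinant is 1).\<close>
definition hankelD :: "real \<Rightarrow> real \<Rightarrow> real \<Rightarrow> nat \<Rightarrow> real \<Rightarrow> real" where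
  "hankelD a A B n t = det (mat n n (\<lambda>(i, j). moment a A B t (i + j)))"

definition hankelH :: "real \<Rightarrow> real \<Rightarrow> real \<Rightarrow> nat \<Rightarrow> real \<Rightarrow> real" where
  "hankelH a A B n t = t * deriv (\<lambda>s. ln (hankelD a A B n s)) t"

end

theory Submission
  imports Defs
begin

text \<open>
  Let \<open>L\<^sub>s\<close> be integration against the weight with its jump at \<open>s\<close>, let \<open>p\<^sub>n\<close> be its monic orthogonal
  polynomials with norms \<open>h\<^sub>n\<close>, and let \<open>W = B s\<^sup>a e\<^sup>-\<^sup>s\<close> be the height of the jump. Two properties of
  \<open>L\<^sub>s\<close> suffice: \<open>d/ds L\<^sub>s q = - W q(s)\<close>, and the Pearson identity
  \<open>L\<^sub>s (x q' + (a + 1 - x) q) = - s W q(s)\<close>.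

  Put \<open>R\<^sub>n = W p\<^sub>n(s)\<^sup>2 / h\<^sub>n\<close> and \<open>r\<^sub>n = W p\<^sub>n(s) p\<^sub>n\<^sub>-\<^sub>1(s) / h\<^sub>n\<^sub>-\<^sub>1\<close>. Since \<open>D\<^sub>n\<close> is the product of the
  norms, \<open>H\<^sub>n = - s (R\<^sub>0 + \<dots> + R\<^sub>n\<^sub>-\<^sub>1)\<close>. The Pearson identity for \<open>p\<^sub>n\<^sup>2\<close> and \<open>p\<^sub>n p\<^sub>n\<^sub>-\<^sub>1\<close> expresses the
  recurrence coefficients as \<open>\<alpha>\<^sub>n = 2n + 1 + a + s R\<^sub>n\<close> and \<open>\<beta>\<^sub>n = s r\<^sub>n + n (n + a) - H\<^sub>n\<close>. It also gives
  \<open>s p\<^sub>n'(s)\<close> in terms of \<open>p\<^sub>n(s)\<close> and \<open>p\<^sub>n\<^sub>-\<^sub>1(s)\<close>, and with the confluent Christoffel--Darboux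
  formula \<open>\<beta>\<^sub>n (R\<^sub>n + R\<^sub>n\<^sub>-\<^sub>1) = r\<^sub>n (s - a - 2n) - H\<^sub>n\<close>. Differentiating \<open>L\<^sub>s (p\<^sub>n p\<^sub>n\<^sub>-\<^sub>1) = 0\<close> and
  \<open>\<beta>\<^sub>n = h\<^sub>n / h\<^sub>n\<^sub>-\<^sub>1\<close> yields \<open>H\<^sub>n' = r\<^sub>n\<close> and \<open>s r\<^sub>n' = \<beta>\<^sub>n (R\<^sub>n\<^sub>-\<^sub>1 - R\<^sub>n)\<close>. Together with
  \<open>r\<^sub>n\<^sup>2 = \<beta>\<^sub>n R\<^sub>n R\<^sub>n\<^sub>-\<^sub>1\<close>, eliminating \<open>R\<^sub>n\<close>, \<open>R\<^sub>n\<^sub>-\<^sub>1\<close> and \<open>r\<^sub>n\<close> gives all the claims.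
\<close>

hide_const (open) module.smult

subsection \<open>Orthogonal polynomials of a positive functional\<close>

text \<open>The Stieltjes procedure: each recurrence coefficient is a quotient of values of
  \<open>L\<close> at polynomials already built. Monicity thus holds for every \<open>L\<close>, and
  differentiability in a parameter is inherited by induction.\<close>

fun mop :: "(real poly \<Rightarrow> real) \<Rightarrow> nat \<Rightarrow> real poly" where
  "mop L 0 = 1"
| "mop L (Suc n) = pCons 0 (mop L n)
     - smult (L (pCons 0 (mop L n * mop L n)) / L (mop L n * mop L n)) (mop L n)
     - (case n of 0 \<Rightarrow> 0
        | Suc m \<Rightarrow> smult (L (mop L n * mop L n) / L (mop L m * mop L m)) (mop L m))"

declare mop.simps(2) [simp del]

definition mnorm :: "(real poly \<Rightarrow> real) \<Rightarrow> nat \<Rightarrow> real" where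
  "mnorm L n = L (mop L n * mop L n)"

definition rec_a :: "(real poly \<Rightarrow> real) \<Rightarrow> nat \<Rightarrow> real" where
  "rec_a L n = L (pCons 0 (mop L n * mop L n)) / mnorm L n"

definition rec_b :: "(real poly \<Rightarrow> real) \<Rightarrow> nat \<Rightarrow> real" where
  "rec_b L n = mnorm L n / mnorm L (n - 1)"

lemma mop_1: "mop L (Suc 0) = pCons 0 1 - smult (rec_a L 0) 1"
  by (simp add: mop.simps(2) rec_a_def mnorm_def)

lemma mop_Suc_Suc:
  "mop L (Suc (Suc n)) = pCons 0 (mop L (Suc n)) - smult (rec_a L (Suc n)) (mop L (Suc n))
     - smult (rec_b L (Suc n)) (mop L n)"
  by (subst mop.simps(2)) (simp add: rec_a_def rec_b_def mnorm_def)

text \<open>Degree and monicity are phrased through coefficients, the form in which linear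
  combinations and parameter derivatives are handled throughout.\<close>

lemma mop_coeffs: "coeff (mop L n) n = 1 \<and> (\<forall>k>n. coeff (mop L n) k = 0)"
proof (induction n rule: less_induct)
  case (less n)
  consider "n = 0" | "n = Suc 0" | m where "n = Suc (Suc m)"
    by (metis not0_implies_Suc)
  then show ?case
  proof cases
    case 1
    then show ?thesis by (simp add: coeff_eq_0)
  next
    case 2
    then show ?thesis by (auto simp: mop_1 coeff_pCons split: nat.splits)
  next
    case 3
    have "coeff (mop L (Suc m)) (Suc m) = 1" "\<And>k. k > Suc m \<Longrightarrow> coeff (mop L (Suc m)) k = 0"
      "\<And>k. k > m \<Longrightarrow> coeff (mop L m) k = 0"
      using less.IH 3 by auto
    then show ?thesis
      by (auto simp: 3 mop_Suc_Suc coeff_pCons split: nat.splits)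
  qed
qed

lemma coeff_mop_self [simp]: "coeff (mop L n) n = 1"
  and coeff_mop_above: "k > n \<Longrightarrow> coeff (mop L n) k = 0"
  using mop_coeffs by auto

lemma mop_nonzero [simp]: "mop L n \<noteq> 0"
  by (metis coeff_0 coeff_mop_self zero_neq_one)

locale positive_functional =
  fixes L :: "real poly \<Rightarrow> real"
  assumes add: "L (p + q) = L p + L q"
    and smult: "L (smult c p) = c * L p"
    and pos: "p \<noteq> 0 \<Longrightarrow> L (p * p) > 0"
begin

lemma zero [simp]: "L 0 = 0"
  using smult[of 0 0] by simp

lemma diff: "L (p - q) = L p - L q"
proof -
  have "L (p - q) = L (p + smult (-1) q)" by simp
  then show ?thesis by (simp only: add smult)
qed

lemmas linear = add diff smult

lemma sum: "L (\<Sum>i\<in>I. f i) = (\<Sum>i\<in>I. L (f i))"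
  by (induction I rule: infinite_finite_induct) (auto simp: add)

lemma mnorm_pos: "mnorm L n > 0"
  unfolding mnorm_def by (rule pos) simp

lemma mnorm_nonzero [simp]: "mnorm L n \<noteq> 0"
  using mnorm_pos[of n] by simp

lemma rec_a_mnorm: "L (pCons 0 (mop L n * mop L n)) = rec_a L n * mnorm L n"
  by (simp add: rec_a_def)

lemma rec_b_mnorm: "rec_b L (Suc n) * mnorm L n = mnorm L (Suc n)"
  by (simp add: rec_b_def)

text \<open>Orthogonality is a premise because the induction in \<open>mop_orthogonal\<close>
  applies this at smaller indices, before the general fact is available.\<close>

lemma leading_part:
  assumes orth: "\<And>q. (\<And>k. k \<ge> n \<Longrightarrow> coeff q k = 0) \<Longrightarrow> L (mop L n * q) = 0"
    and deg: "\<And>k. k > n \<Longrightarrow> coeff q k = 0"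
  shows "L (mop L n * q) = coeff q n * mnorm L n"
proof -
  have "L (mop L n * (q - smult (coeff q n) (mop L n))) = 0"
  proof (rule orth)
    fix k assume "k \<ge> n"
    then show "coeff (q - smult (coeff q n) (mop L n)) k = 0"
      by (cases "k = n") (auto simp: deg coeff_mop_above)
  qed
  then show ?thesis
    by (simp add: right_diff_distrib linear mnorm_def)
qed

lemma mop_orthogonal:
  assumes "\<And>k. k \<ge> n \<Longrightarrow> coeff q k = 0"
  shows "L (mop L n * q) = 0"
  using assms
proof (induction n arbitrary: q rule: less_induct)
  case (less n)
  show ?case
  proof (cases n)
    case 0
    then have "q = 0" using less.prems by (simp add: poly_eq_iff)
    then show ?thesis by simp
  next
    case (Suc m)
    define c where "c = coeff q m"
    define q1 where "q1 = q - smult c (mop L m)"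
    have q1: "coeff q1 k = 0" if "k \<ge> m" for k
      using that less.prems[of k] Suc
      by (cases "k = m") (auto simp: q1_def c_def coeff_mop_above)
    have split: "L (mop L n * q) = L (mop L n * q1) + c * L (mop L n * mop L m)"
      by (simp add: q1_def right_diff_distrib linear)
    show ?thesis
    proof (cases m)
      case 0
      then have "q1 = 0" using q1 by (simp add: poly_eq_iff)
      moreover have "L (pCons 0 1 - smult (rec_a L 0) 1) = 0"
        using rec_a_mnorm[of 0] unfolding linear by (simp add: mnorm_def)
      then have "L (mop L n * mop L m) = 0"
        by (simp only: Suc 0 mop_1 mop.simps(1) mult_1_right)
      ultimately show ?thesis using split by simp
    next
      case m: (Suc k)
      have lead: "L (mop L j * r) = coeff r j * mnorm L j"
        if "j < n" "\<And>i. i > j \<Longrightarrow> coeff r i = 0" for j r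
        by (rule leading_part) (use less.IH that in auto)
      have 1: "L (mop L m * q1) = 0"
        using less.IH[of m q1] q1 Suc by auto
      have 2: "L (mop L m * pCons 0 q1) = coeff q1 k * mnorm L m"
        by (subst lead) (use Suc m q1 in \<open>auto simp: coeff_pCons split: nat.splits\<close>)
      have 3: "L (mop L k * q1) = coeff q1 k * mnorm L k"
        by (rule lead) (use Suc m q1 in auto)
      have 4: "L (mop L k * mop L m) = 0"
        by (subst mult.commute, rule less.IH) (use Suc m in \<open>auto simp: coeff_mop_above\<close>)
      \<comment> \<open>The recurrence for \<open>mop L n\<close> leaves the contributions
        \<open>2\<close> and \<open>3\<close>, which cancel because \<open>rec_b\<close> is the
        quotient of the norms; against \<open>mop L m\<close> below, it is the choice of
        \<open>rec_a\<close> that gives zero.\<close>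
      have "L (mop L n * q1) = 0"
        using 1 2 3 rec_b_mnorm[of k] unfolding Suc m mop_Suc_Suc
        by (simp add: left_diff_distrib linear)
      moreover have "L (mop L n * mop L m) = 0"
        using 4 rec_a_mnorm[of m] unfolding Suc m mop_Suc_Suc
        by (simp add: left_diff_distrib linear mnorm_def)
      ultimately show ?thesis using split by simp
    qed
  qed
qed

lemma mop_times_leading:
  assumes "\<And>k. k > n \<Longrightarrow> coeff q k = 0"
  shows "L (mop L n * q) = coeff q n * mnorm L n"
  by (rule leading_part) (use assms mop_orthogonal in auto)

lemma mop_mop: "m < n \<Longrightarrow> L (mop L n * mop L m) = 0"
  by (rule mop_orthogonal) (simp add: coeff_mop_above)

lemma mop_X_mop: "L (pCons 0 (mop L (Suc n) * mop L n)) = mnorm L (Suc n)"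
proof -
  have "L (mop L (Suc n) * pCons 0 (mop L n)) = mnorm L (Suc n)"
    by (subst mop_times_leading) (auto simp: coeff_pCons coeff_mop_above split: nat.splits)
  then show ?thesis by simp
qed

lemma mop_unique:
  assumes "coeff q n = 1" "\<And>k. k > n \<Longrightarrow> coeff q k = 0"
    and "\<And>m. m < n \<Longrightarrow> L (q * mop L m) = 0"
  shows "q = mop L n"
proof -
  define d where "d = q - mop L n"
  have ortho: "L (d * mop L m) = 0" if "m < n" for m
    using that assms(3)[of m] mop_mop[of m n] by (simp add: d_def left_diff_distrib linear)
  \<comment> \<open>The coefficients of \<open>d\<close> are killed from the top down; once
    \<open>k\<close> reaches \<open>n\<close>, truncated subtraction makes this cover all of
    them.\<close>
  have "\<forall>i\<ge>n - k. coeff d i = 0" for k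
  proof (induction k)
    case 0
    have "coeff d i = 0" if "i \<ge> n" for i
      using that assms(1) assms(2)[of i] coeff_mop_above[of n i L]
      by (cases "i = n") (auto simp: d_def)
    then show ?case by simp
  next
    case (Suc k)
    show ?case
    proof (cases "n \<le> k")
      case False
      define m where "m = n - Suc k"
      have m: "m < n" "n - k = Suc m" using False by (auto simp: m_def)
      have "L (mop L m * d) = coeff d m * mnorm L m"
        by (rule mop_times_leading) (use Suc m in auto)
      then have "coeff d m = 0"
        using ortho[of m] m by (simp add: mult.commute)
      then show ?thesis using Suc m unfolding m_def[symmetric]
        by (metis Suc_leI le_neq_implies_less)
    qed (use Suc in auto)
  qed
  from this[of n] have "d = 0" by (simp add: poly_eq_iff)
  then show ?thesis by (simp add: d_def)
qed

lemma mop_expansion: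
  assumes "\<And>k. k \<ge> n \<Longrightarrow> coeff q k = 0"
  shows "q = (\<Sum>j<n. smult (L (q * mop L j) / mnorm L j) (mop L j))"
  using assms
proof (induction n arbitrary: q)
  case 0
  then show ?case by (simp add: poly_eq_iff)
next
  case (Suc n)
  define c where "c = coeff q n"
  have c: "L (q * mop L n) / mnorm L n = c"
    using mop_times_leading[of n q] Suc.prems by (simp add: c_def mult.commute)
  define r where "r = q - smult c (mop L n)"
  have "coeff r k = 0" if "k \<ge> n" for k
    using that Suc.prems[of k] by (cases "k = n") (auto simp: r_def c_def coeff_mop_above)
  then have "r = (\<Sum>j<n. smult (L (r * mop L j) / mnorm L j) (mop L j))"
    by (rule Suc.IH)
  also have "\<dots> = (\<Sum>j<n. smult (L (q * mop L j) / mnorm L j) (mop L j))"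
    by (rule sum.cong) (auto simp: r_def left_diff_distrib linear mop_mop)
  finally show ?case using c by (simp add: r_def algebra_simps)
qed

text \<open>The recurrence adds \<open>- rec_a\<close> to this coefficient at each step. It later
  makes \<open>jump_H\<close> a coefficient of a polynomial, up to a constant.\<close>

lemma coeff_mop_subleading: "coeff (mop L (Suc n)) n = - (\<Sum>j\<le>n. rec_a L j)"
proof (induction n)
  case 0
  then show ?case by (simp add: mop_1)
next
  case (Suc n)
  then show ?case
    by (simp add: mop_Suc_Suc coeff_mop_above)
qed

end

text \<open>In the recurrence, the \<open>rec_a\<close> terms cancel, the \<open>rec_b\<close> term
  reproduces the induction hypothesis, and differentiating the factor \<open>x\<close> yields the
  new square.\<close>

lemma christoffel_darboux_diagonal:
  assumes "positive_functional L"
  shows "(\<Sum>j\<le>n. (poly (mop L j) x)\<^sup>2 / mnorm L j) * mnorm L n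
    = poly (pderiv (mop L (Suc n))) x * poly (mop L n) x
      - poly (mop L (Suc n)) x * poly (pderiv (mop L n)) x"
proof (induction n)
  case 0
  interpret positive_functional L by fact
  have "mnorm L 0 \<noteq> 0" by simp
  then show ?case by (simp add: mop_1 pderiv_diff pderiv_pCons pderiv_smult)
next
  case (Suc n)
  interpret positive_functional L by fact
  have nz: "mnorm L n \<noteq> 0" "mnorm L (Suc n) \<noteq> 0" by simp_all
  let ?S = "\<Sum>j\<le>n. (poly (mop L j) x)\<^sup>2 / mnorm L j"
  have "(\<Sum>j\<le>Suc n. (poly (mop L j) x)\<^sup>2 / mnorm L j) * mnorm L (Suc n)
      = rec_b L (Suc n) * (?S * mnorm L n) + (poly (mop L (Suc n)) x)\<^sup>2"
    using nz rec_b_mnorm[of n, symmetric] by (simp add: field_simps)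
  also have "\<dots> = poly (pderiv (mop L (Suc (Suc n)))) x * poly (mop L (Suc n)) x
      - poly (mop L (Suc (Suc n))) x * poly (pderiv (mop L (Suc n))) x"
    unfolding Suc.IH mop_Suc_Suc
    by (simp add: pderiv_diff pderiv_add pderiv_pCons pderiv_smult algebra_simps power2_eq_square)
  finally show ?case .
qed

subsection \<open>Consequences of the Pearson identity\<close>

definition jump_R :: "(real poly \<Rightarrow> real) \<Rightarrow> real \<Rightarrow> real \<Rightarrow> nat \<Rightarrow> real" where
  "jump_R L W s n = W * (poly (mop L n) s)\<^sup>2 / mnorm L n"

text \<open>The index is shifted: \<open>jump_r \<dots> n\<close> is \<open>r\<^sub>n\<^sub>+\<^sub>1\<close>.\<close>

definition jump_r :: "(real poly \<Rightarrow> real) \<Rightarrow> real \<Rightarrow> real \<Rightarrow> nat \<Rightarrow> real" where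
  "jump_r L W s n = W * poly (mop L (Suc n)) s * poly (mop L n) s / mnorm L n"

text \<open>Stands in for \<open>hankelH\<close>; \<open>hankelH_eq_jump_H\<close> identifies the
  two for the concrete weight.\<close>

definition jump_H :: "(real poly \<Rightarrow> real) \<Rightarrow> real \<Rightarrow> real \<Rightarrow> nat \<Rightarrow> real" where
  "jump_H L W s n = - s * (\<Sum>j<n. jump_R L W s j)"

lemma jump_H_Suc: "jump_H L W s (Suc n) = jump_H L W s n - s * jump_R L W s n"
  by (simp add: jump_H_def algebra_simps)

locale jump_functional = positive_functional L for L +
  fixes a s W :: real
  assumes pearson:
    "L (pCons 0 (pderiv q) + smult (a + 1) q - pCons 0 q) = - s * W * poly q s"
begin

abbreviation p where "p \<equiv> mop L"
abbreviation h where "h \<equiv> mnorm L"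
abbreviation R where "R \<equiv> jump_R L W s"
abbreviation r where "r \<equiv> jump_r L W s"
abbreviation H where "H \<equiv> jump_H L W s"

lemma mop_X_pderiv_self: "L (p n * pCons 0 (pderiv (p n))) = n * h n"
proof (cases n)
  case (Suc m)
  then show ?thesis
    by (subst mop_times_leading) (auto simp: coeff_pCons coeff_pderiv coeff_mop_above split: nat.splits)
qed simp

lemma mop_X_pderiv_lower: "m < n \<Longrightarrow> L (p n * pCons 0 (pderiv (p m))) = 0"
  by (rule mop_orthogonal) (auto simp: coeff_pCons coeff_pderiv coeff_mop_above split: nat.splits)

text \<open>The Pearson identity at \<open>p n * p n\<close>: its three terms contribute
  \<open>2 * n * h n\<close>, \<open>(a + 1) * h n\<close> and
  \<open>- rec_a L n * h n\<close>.\<close>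

lemma rec_a_eq: "rec_a L n = 2 * n + 1 + a + s * R n"
proof -
  have "L (pCons 0 (pderiv (p n * p n))) = 2 * L (p n * pCons 0 (pderiv (p n)))"
    by (simp add: pderiv_mult add smult flip: mult_2)
      (metis add add_0 add_pCons mult.commute mult_2)
  then have "2 * (n * h n) + (a + 1) * h n - rec_a L n * h n = - s * W * (poly (p n) s)\<^sup>2"
    using pearson[of "p n * p n"] mop_X_pderiv_self[of n] rec_a_mnorm[of n]
    by (simp add: linear mnorm_def power2_eq_square)
  then show ?thesis
    by (simp add: jump_R_def field_simps)
qed

lemma subleading: "coeff (p (Suc n)) n = H (Suc n) - (n + 1) * (n + 1 + a)"
proof -
  have "(\<Sum>j\<le>n. rec_a L j) = (n + 1) * (n + 1 + a) - H (Suc n)" for n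
  proof (induction n)
    case 0
    then show ?case by (simp add: rec_a_eq jump_H_def)
  next
    case (Suc n)
    then show ?case
      by (simp add: rec_a_eq jump_H_Suc[of _ _ _ "Suc n"] algebra_simps)
  qed
  then show ?thesis by (simp add: coeff_mop_subleading)
qed

text \<open>The Pearson identity at \<open>p n * p m\<close>; the middle term and the one with
  \<open>pderiv (p m)\<close> vanish by orthogonality.\<close>

lemma X_pderiv_mop:
  assumes "m < n"
  shows "L (pCons 0 (pderiv (p n)) * p m)
    = L (pCons 0 (p n * p m)) - s * W * poly (p n) s * poly (p m) s"
proof -
  have "L (pCons 0 (pderiv (p n * p m))) = L (pCons 0 (pderiv (p n)) * p m + p n * pCons 0 (pderiv (p m)))"
    by (simp add: pderiv_mult algebra_simps)
  then show ?thesis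
    using pearson[of "p n * p m"] mop_mop[OF assms] mop_X_pderiv_lower[OF assms]
    by (simp add: linear del: mult_pCons_left mult_pCons_right)
qed

lemma rec_b_eq: "rec_b L (Suc n) = s * r n + (n + 1) * (n + 1 + a) - H (Suc n)"
proof -
  \<comment> \<open>Subtracting \<open>n + 1\<close> copies cancels the leading term, so
    \<open>q\<close> has degree at most \<open>n\<close>, and \<open>L (p n * q)\<close> can be
    computed both from its coefficient at \<open>n\<close> and from the Pearson identity.\<close>
  define q where "q = pCons 0 (pderiv (p (Suc n))) - smult (n + 1) (p (Suc n))"
  have q: "coeff q k = 0" if "k > n" for k
    using that by (cases "k = Suc n")
      (auto simp: q_def coeff_pCons coeff_pderiv coeff_mop_above split: nat.splits)
  have "coeff q n = - coeff (p (Suc n)) n"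
    by (cases n) (simp_all add: q_def coeff_pderiv algebra_simps)
  then have "coeff q n = (real n + 1) * (real n + 1 + a) - H (Suc n)"
    by (simp only: subleading minus_diff_eq)
  then have "L (p n * q) = ((real n + 1) * (real n + 1 + a) - H (Suc n)) * h n"
    using mop_times_leading[of n q] q by simp
  moreover have "p n * q = pCons 0 (pderiv (p (Suc n))) * p n - smult (n + 1) (p (Suc n) * p n)"
    by (simp add: q_def algebra_simps)
  then have "L (p n * q) = h (Suc n) - s * W * poly (p (Suc n)) s * poly (p n) s"
    using X_pderiv_mop[of n "Suc n"] mop_mop[of n "Suc n"] mop_X_mop[of n]
    by (simp only: linear)
  ultimately have "((real n + 1) * (real n + 1 + a) - H (Suc n)) * h n
    = h (Suc n) - s * W * poly (p (Suc n)) s * poly (p n) s" by simp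
  then show ?thesis
    by (simp add: jump_r_def rec_b_def field_simps)
qed

text \<open>Expand the same \<open>q\<close> in the orthogonal basis. The jump terms of its
  coefficients, evaluated at \<open>s\<close>, add up to \<open>H (Suc n)\<close>; the extra term at
  \<open>j = n\<close> gives \<open>rec_b\<close>.\<close>

lemma pderiv_mop_at:
  "s * poly (pderiv (p (Suc n))) s
    = (n + 1 + H (Suc n)) * poly (p (Suc n)) s + rec_b L (Suc n) * poly (p n) s"
proof -
  define q where "q = pCons 0 (pderiv (p (Suc n))) - smult (n + 1) (p (Suc n))"
  have q: "coeff q k = 0" if "k \<ge> Suc n" for k
    using that by (cases "k = Suc n")
      (auto simp: q_def coeff_pCons coeff_pderiv coeff_mop_above split: nat.splits)
  have Lq: "L (q * p j) = (if j = n then h (Suc n) else 0)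
      - s * W * poly (p (Suc n)) s * poly (p j) s" if "j < Suc n" for j
  proof -
    have "L (q * p j) = L (pCons 0 (pderiv (p (Suc n))) * p j)"
      using mop_mop[OF that] by (simp add: q_def left_diff_distrib linear)
    moreover have "L (p (Suc n) * pCons 0 (p j)) = 0" if "j < n"
      by (rule mop_orthogonal) (use that in \<open>auto simp: coeff_pCons coeff_mop_above split: nat.splits\<close>)
    ultimately show ?thesis
      using X_pderiv_mop[OF that] mop_X_mop[of n] that by (cases "j = n") auto
  qed
  have "poly q s = (\<Sum>j<Suc n. L (q * p j) / h j * poly (p j) s)"
    using arg_cong[OF mop_expansion[of "Suc n" q], of "\<lambda>q. poly q s"] q
    by (simp add: poly_sum)
  also have "\<dots> = (\<Sum>j<Suc n. (if j = n then h (Suc n) / h n * poly (p n) s else 0)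
      - s * poly (p (Suc n)) s * R j)"
    by (rule sum.cong) (auto simp: Lq jump_R_def power2_eq_square diff_divide_distrib algebra_simps)
  also have "\<dots> = rec_b L (Suc n) * poly (p n) s + H (Suc n) * poly (p (Suc n)) s"
    unfolding sum_subtractf sum_distrib_left[symmetric] by (simp add: jump_H_def rec_b_def)
  finally show ?thesis by (simp add: q_def algebra_simps)
qed

text \<open>The previous relation one index lower, with the lowest polynomial eliminated by the
  recurrence, so that it also makes sense at \<open>n = 0\<close>.\<close>

lemma pderiv_mop_at_lower:
  "s * poly (pderiv (p n)) s
    = (n + H n + s - rec_a L n) * poly (p n) s - poly (p (Suc n)) s"
proof (cases n)
  case 0
  then show ?thesis by (simp add: mop_1 jump_H_def algebra_simps)
next
  case (Suc m)
  then show ?thesis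
    by (simp only: pderiv_mop_at mop_Suc_Suc) (simp add: algebra_simps)
qed

lemma r_square: "(r n)\<^sup>2 = rec_b L (Suc n) * R (Suc n) * R n"
  using mnorm_pos[of n] mnorm_pos[of "Suc n"]
  by (simp add: jump_r_def jump_R_def rec_b_def field_simps power2_eq_square)

text \<open>The confluent Christoffel-Darboux formula at \<open>s\<close>, multiplied by
  \<open>s * W\<close>, with both derivatives replaced by the two preceding relations.\<close>

lemma R_sum:
  "rec_b L (Suc n) * (R (Suc n) + R n) = r n * (s - a - 2 * (real n + 1)) - H (Suc n)"
proof -
  let ?P = "poly (p (Suc n)) s" and ?Q = "poly (p n) s"
  have "(\<Sum>j\<le>n. (poly (p j) s)\<^sup>2 / h j) * h n * (s * W)
      = W * ((s * poly (pderiv (p (Suc n))) s) * ?Q - ?P * (s * poly (pderiv (p n)) s))"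
    unfolding christoffel_darboux_diagonal[OF positive_functional_axioms, of s n]
    by (simp add: algebra_simps)
  also have "\<dots> = W * (((real n + 1 + H (Suc n)) * ?P + rec_b L (Suc n) * ?Q) * ?Q
      - ?P * ((real n + H n + s - rec_a L n) * ?Q - ?P))"
    by (simp only: pderiv_mop_at pderiv_mop_at_lower[of n])
  finally have eq: "(\<Sum>j\<le>n. (poly (p j) s)\<^sup>2 / h j) * h n * (s * W)
      = W * (((real n + 1 + H (Suc n)) * ?P + rec_b L (Suc n) * ?Q) * ?Q
      - ?P * ((real n + H n + s - rec_a L n) * ?Q - ?P))" .
  have "(\<Sum>j\<le>n. (poly (p j) s)\<^sup>2 / h j) * (s * W) = - H (Suc n)"
    by (simp add: jump_H_def jump_R_def lessThan_Suc_atMost sum_distrib_left sum_negf algebra_simps)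
  with eq have "- H (Suc n) * h n = W * (((real n + 1 + H (Suc n)) * ?P + rec_b L (Suc n) * ?Q) * ?Q
      - ?P * ((real n + H n + s - rec_a L n) * ?Q - ?P))"
    by (metis mult.assoc mult.commute)
  \<comment> \<open>The difference of \<open>H (Suc n)\<close> and \<open>H n\<close> is
    \<open>- s * R n\<close>, which cancels the \<open>s * R n\<close> inside
    \<open>rec_a L n\<close>.\<close>
  also have "\<dots> = (W * ?P * ?Q) * (2 * (real n + 1) + a - s) + rec_b L (Suc n) * (W * ?Q\<^sup>2) + W * ?P\<^sup>2"
    unfolding rec_a_eq jump_H_Suc by (simp add: algebra_simps power2_eq_square)
  also have "W * ?P\<^sup>2 = R (Suc n) * rec_b L (Suc n) * h n"
    using mnorm_pos[of n] mnorm_pos[of "Suc n"] by (simp add: jump_R_def rec_b_def)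
  also have "W * ?Q\<^sup>2 = R n * h n" by (simp add: jump_R_def)
  also have "W * ?P * ?Q = r n * h n" by (simp add: jump_r_def)
  finally have "- H (Suc n) * h n
    = (r n * (2 * (real n + 1) + a - s) + rec_b L (Suc n) * R n + R (Suc n) * rec_b L (Suc n)) * h n"
    by (simp add: algebra_simps)
  then have "- H (Suc n)
    = r n * (2 * (real n + 1) + a - s) + rec_b L (Suc n) * R n + R (Suc n) * rec_b L (Suc n)"
    by (simp only: mult_right_cancel[OF mnorm_nonzero])
  then show ?thesis by (simp add: algebra_simps)
qed

end

subsection \<open>Dependence on the position of the jump\<close>

text \<open>Differentiability of a path of polynomials at \<open>s\<close>. The degree bound is
  uniform in \<open>u\<close>, so that evaluating a functional is a sum over a fixed finite index
  set.\<close>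

definition has_coeff_deriv :: "(real \<Rightarrow> real poly) \<Rightarrow> real poly \<Rightarrow> real \<Rightarrow> nat \<Rightarrow> bool" where
  "has_coeff_deriv p p' s N \<longleftrightarrow>
     (\<forall>k. ((\<lambda>u. coeff (p u) k) has_real_derivative coeff p' k) (at s)) \<and>
     (\<forall>u. \<forall>k>N. coeff (p u) k = 0)"

lemma has_coeff_deriv_const: "degree p \<le> N \<Longrightarrow> has_coeff_deriv (\<lambda>u. p) 0 s N"
  by (simp add: has_coeff_deriv_def coeff_eq_0)

lemma has_coeff_deriv_pCons:
  assumes "has_coeff_deriv p p' s N"
  shows "has_coeff_deriv (\<lambda>u. pCons 0 (p u)) (pCons 0 p') s (Suc N)"
  using assms by (auto simp: has_coeff_deriv_def coeff_pCons split: nat.splits)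

lemma has_coeff_deriv_diff:
  assumes "has_coeff_deriv p p' s N" "has_coeff_deriv q q' s N"
  shows "has_coeff_deriv (\<lambda>u. p u - q u) (p' - q') s N"
  using assms by (auto simp: has_coeff_deriv_def intro!: DERIV_diff)

lemma has_coeff_deriv_smult:
  assumes "(c has_real_derivative c') (at s)" "has_coeff_deriv p p' s N"
  shows "has_coeff_deriv (\<lambda>u. smult (c u) (p u)) (smult c' (p s) + smult (c s) p') s N"
  using assms by (auto simp: has_coeff_deriv_def mult.commute intro!: derivative_eq_intros)

lemma has_coeff_deriv_mono:
  "has_coeff_deriv p p' s M \<Longrightarrow> M \<le> N \<Longrightarrow> has_coeff_deriv p p' s N"
  by (auto simp: has_coeff_deriv_def)

lemma has_coeff_deriv_mult:
  assumes p: "has_coeff_deriv p p' s M" and q: "has_coeff_deriv q q' s N"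
  shows "has_coeff_deriv (\<lambda>u. p u * q u) (p' * q s + p s * q') s (M + N)"
  unfolding has_coeff_deriv_def
proof (intro conjI allI impI)
  fix k
  have "((\<lambda>u. \<Sum>i\<le>k. coeff (p u) i * coeff (q u) (k - i)) has_real_derivative
      (\<Sum>i\<le>k. coeff p' i * coeff (q s) (k - i) + coeff q' (k - i) * coeff (p s) i)) (at s)"
    using p q by (intro DERIV_sum DERIV_mult) (auto simp: has_coeff_deriv_def)
  then show "((\<lambda>u. coeff (p u * q u) k) has_real_derivative coeff (p' * q s + p s * q') k) (at s)"
    by (simp add: coeff_mult sum.distrib mult.commute[of "coeff q' _"])
next
  fix u k assume "M + N < k"
  moreover have "degree (p u * q u) \<le> M + N"
  proof -
    have "degree (p u) \<le> M" "degree (q u) \<le> N"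
      using p q by (auto simp: has_coeff_deriv_def intro: degree_le)
    then show ?thesis using degree_mult_le[of "p u" "q u"] by linarith
  qed
  ultimately show "coeff (p u * q u) k = 0" by (intro coeff_eq_0) simp
qed

text \<open>Applied to the leading coefficient 1: the derivative of a monic path has lower degree,
  hence is orthogonal to the path at \<open>s\<close>.\<close>

lemma has_coeff_deriv_fixed_coeff:
  assumes "has_coeff_deriv p p' s N" "\<And>u. coeff (p u) k = c"
  shows "coeff p' k = 0"
proof -
  have "((\<lambda>u. coeff (p u) k) has_real_derivative coeff p' k) (at s)"
    using assms(1) unfolding has_coeff_deriv_def by blast
  then have "((\<lambda>u. c) has_real_derivative coeff p' k) (at s)"
    by (simp add: assms(2))
  then show ?thesis using DERIV_unique DERIV_const by blast
qed

lemma has_coeff_deriv_above: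
  assumes "has_coeff_deriv p p' s N" "k > N"
  shows "coeff p' k = 0"
  by (rule has_coeff_deriv_fixed_coeff[OF assms(1), of _ 0])
    (use assms in \<open>auto simp: has_coeff_deriv_def\<close>)

lemma (in positive_functional) eq_sum_monom:
  assumes "\<And>k. k > N \<Longrightarrow> coeff p k = 0"
  shows "L p = (\<Sum>k\<le>N. coeff p k * L (monom 1 k))"
proof -
  have "degree p \<le> N" using assms by (auto intro: degree_le)
  then have "L p = L (\<Sum>i\<le>N. monom (coeff p i) i)"
    by (simp add: poly_as_sum_of_monoms')
  also have "\<dots> = L (\<Sum>i\<le>N. smult (coeff p i) (monom 1 i))"
    by (simp add: smult_monom)
  finally show ?thesis by (simp add: sum smult)
qed

locale jump_family =
  fixes L :: "real \<Rightarrow> real poly \<Rightarrow> real" and W :: "real \<Rightarrow> real" and a :: real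
  assumes jump: "s > 0 \<Longrightarrow> jump_functional (L s) a s (W s)"
    and deriv: "s > 0 \<Longrightarrow> ((\<lambda>u. L u q) has_real_derivative - W s * poly q s) (at s)"
begin

text \<open>The identities for \<open>L u\<close> hold only for \<open>u > 0\<close>, an open
  condition, which suffices for differentiating them at \<open>s\<close>.\<close>

lemma transform_deriv:
  assumes "(f has_real_derivative D) (at s)" "s > 0" "\<And>u. u > 0 \<Longrightarrow> f u = g u"
  shows "(g has_real_derivative D) (at s)"
  by (rule has_field_derivative_transform_within_open[of f D s "{0<..}"]) (use assms in auto)

text \<open>The product rule applied to the expansion in moments: one term from the moving
  polynomial, one from the moving jump.\<close>

lemma deriv_family:
  assumes "s > 0" and p: "has_coeff_deriv p p' s N"
  shows "((\<lambda>u. L u (p u)) has_real_derivative L s p' - W s * poly (p s) s) (at s)"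
proof -
  have *: "L u (p u) = (\<Sum>k\<le>N. coeff (p u) k * L u (monom 1 k))" if "u > 0" for u
  proof -
    interpret jump_functional "L u" a u "W u" by (rule jump) fact
    show ?thesis by (rule eq_sum_monom) (use p in \<open>auto simp: has_coeff_deriv_def\<close>)
  qed
  interpret jump_functional "L s" a s "W s" by (rule jump) fact
  have "((\<lambda>u. \<Sum>k\<le>N. coeff (p u) k * L u (monom 1 k)) has_real_derivative
     (\<Sum>k\<le>N. coeff p' k * L s (monom 1 k) + - W s * poly (monom 1 k) s * coeff (p s) k)) (at s)"
    by (intro DERIV_sum DERIV_mult deriv) (use assms in \<open>auto simp: has_coeff_deriv_def\<close>)
  moreover have "L s p' = (\<Sum>k\<le>N. coeff p' k * L s (monom 1 k))"
    by (rule eq_sum_monom) (use has_coeff_deriv_above[OF p] in auto)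
  moreover have "poly (p s) s = (\<Sum>k\<le>N. coeff (p s) k * s ^ k)"
  proof -
    have "degree (p s) \<le> N" using p by (auto simp: has_coeff_deriv_def intro: degree_le)
    then have "poly (p s) s = poly (\<Sum>i\<le>N. monom (coeff (p s) i) i) s"
      by (simp add: poly_as_sum_of_monoms')
    then show ?thesis by (simp add: poly_sum poly_monom)
  qed
  ultimately have "((\<lambda>u. \<Sum>k\<le>N. coeff (p u) k * L u (monom 1 k)) has_real_derivative
     L s p' - W s * poly (p s) s) (at s)"
    by (simp add: sum.distrib poly_monom sum_distrib_left sum_negf mult_ac sum_subtractf)
  then show ?thesis by (rule transform_deriv) (use assms(1) * in auto)
qed

text \<open>Only existence is needed here; the relevant derivatives are then forced by
  orthogonality.\<close>

lemma mop_has_coeff_deriv: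
  assumes "s > 0"
  shows "\<exists>p'. has_coeff_deriv (\<lambda>u. mop (L u) n) p' s n"
proof (induction n rule: less_induct)
  case (less n)
  interpret jump_functional "L s" a s "W s" by (rule jump) fact
  have norm: "\<exists>D. ((\<lambda>u. mnorm (L u) j) has_real_derivative D) (at s)"
    and rec_a: "\<exists>D. ((\<lambda>u. rec_a (L u) j) has_real_derivative D) (at s)" if j: "j < n" for j
  proof -
    obtain p' where p': "has_coeff_deriv (\<lambda>u. mop (L u) j) p' s j"
      using less j by blast
    note * = has_coeff_deriv_mult[OF p' p']
    from deriv_family[OF assms *]
    obtain D where D: "((\<lambda>u. mnorm (L u) j) has_real_derivative D) (at s)"
      unfolding mnorm_def by blast
    then show "\<exists>D. ((\<lambda>u. mnorm (L u) j) has_real_derivative D) (at s)" ..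
    from deriv_family[OF assms has_coeff_deriv_pCons[OF *]]
    obtain E where E: "((\<lambda>u. L u (pCons 0 (mop (L u) j * mop (L u) j))) has_real_derivative E) (at s)"
      by blast
    from DERIV_divide[OF E D] show "\<exists>D. ((\<lambda>u. rec_a (L u) j) has_real_derivative D) (at s)"
      unfolding rec_a_def by auto
  qed
  have rec_b: "\<exists>D. ((\<lambda>u. rec_b (L u) (Suc j)) has_real_derivative D) (at s)" if "Suc j < n" for j
  proof -
    obtain D E where "((\<lambda>u. mnorm (L u) (Suc j)) has_real_derivative D) (at s)"
      "((\<lambda>u. mnorm (L u) j) has_real_derivative E) (at s)"
      using norm[of j] norm[of "Suc j"] \<open>Suc j < n\<close> by auto
    from DERIV_divide[OF this] show ?thesis by (auto simp: rec_b_def)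
  qed
  consider "n = 0" | "n = Suc 0" | m where "n = Suc (Suc m)"
    by (metis not0_implies_Suc)
  then show ?case
  proof cases
    case 1
    then show ?thesis using has_coeff_deriv_const[of 1 0 s] by auto
  next
    case 2
    then obtain D where "((\<lambda>u. rec_a (L u) 0) has_real_derivative D) (at s)"
      using rec_a by blast
    from has_coeff_deriv_smult[OF this has_coeff_deriv_const[of 1 "Suc 0" s]]
    have "has_coeff_deriv (\<lambda>u. smult (rec_a (L u) 0) 1) (smult D 1 + smult (rec_a (L s) 0) 0) s (Suc 0)"
      by simp
    from has_coeff_deriv_diff[OF has_coeff_deriv_const[of "pCons 0 1" "Suc 0" s] this]
    show ?thesis unfolding 2 mop_1 by auto
  next
    case 3
    obtain p' q' where p': "has_coeff_deriv (\<lambda>u. mop (L u) (Suc m)) p' s (Suc m)"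
      and q': "has_coeff_deriv (\<lambda>u. mop (L u) m) q' s m"
      using less[of m] less[of "Suc m"] 3 by auto
    obtain D E where D: "((\<lambda>u. rec_a (L u) (Suc m)) has_real_derivative D) (at s)"
      and E: "((\<lambda>u. rec_b (L u) (Suc m)) has_real_derivative E) (at s)"
      using rec_a[of "Suc m"] rec_b[of m] 3 by auto
    have le: "Suc m \<le> Suc (Suc m)" "m \<le> Suc (Suc m)" by auto
    from has_coeff_deriv_diff[OF has_coeff_deriv_diff[OF has_coeff_deriv_pCons[OF p']
        has_coeff_deriv_mono[OF has_coeff_deriv_smult[OF D p'] le(1)]]
        has_coeff_deriv_mono[OF has_coeff_deriv_smult[OF E q'] le(2)]]
    show ?thesis unfolding 3 mop_Suc_Suc by blast
  qed
qed

text \<open>Both terms with the derivative of the polynomial vanish by orthogonality, which leaves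
  the jump.\<close>

lemma mnorm_deriv:
  assumes "s > 0"
  shows "((\<lambda>u. mnorm (L u) n) has_real_derivative
    - jump_R (L s) (W s) s n * mnorm (L s) n) (at s)"
proof -
  interpret jump_functional "L s" a s "W s" by (rule jump) fact
  obtain p' where p': "has_coeff_deriv (\<lambda>u. mop (L u) n) p' s n"
    using mop_has_coeff_deriv[OF assms] by blast
  then have "coeff p' n = 0" by (rule has_coeff_deriv_fixed_coeff) (rule coeff_mop_self)
  then have "coeff p' k = 0" if "k \<ge> n" for k
    using that has_coeff_deriv_above[OF p'] by (cases "k = n") auto
  then have "L s (mop (L s) n * p') = 0" by (rule mop_orthogonal)
  then have "L s (p' * mop (L s) n + mop (L s) n * p') = 0"
    by (simp only: add mult.commute[of p'])
  moreover have "W s * poly (mop (L s) n * mop (L s) n) s = jump_R (L s) (W s) s n * mnorm (L s) n"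
    by (simp add: jump_R_def power2_eq_square)
  ultimately show ?thesis
    using deriv_family[OF assms has_coeff_deriv_mult[OF p' p']]
    by (simp add: mnorm_def)
qed

text \<open>Differentiate the orthogonality of consecutive polynomials: \<open>q'\<close> has too
  low a degree to contribute, and \<open>p'\<close> contributes only the coefficient sought.\<close>

lemma coeff_subleading_deriv:
  assumes "s > 0"
  shows "((\<lambda>u. coeff (mop (L u) (Suc n)) n) has_real_derivative jump_r (L s) (W s) s n) (at s)"
proof -
  interpret jump_functional "L s" a s "W s" by (rule jump) fact
  obtain p' where p': "has_coeff_deriv (\<lambda>u. mop (L u) (Suc n)) p' s (Suc n)"
    using mop_has_coeff_deriv[OF assms] by blast
  obtain q' where q': "has_coeff_deriv (\<lambda>u. mop (L u) n) q' s n"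
    using mop_has_coeff_deriv[OF assms] by blast
  have "coeff p' (Suc n) = 0"
    using p' by (rule has_coeff_deriv_fixed_coeff) (rule coeff_mop_self)
  then have "coeff p' k = 0" if "k > n" for k
    using that has_coeff_deriv_above[OF p'] by (cases "k = Suc n") auto
  then have 1: "L s (mop (L s) n * p') = coeff p' n * mnorm (L s) n"
    by (rule mop_times_leading)
  have 2: "L s (mop (L s) (Suc n) * q') = 0"
    by (rule mop_orthogonal) (use has_coeff_deriv_above[OF q'] in auto)
  have "((\<lambda>u. 0) has_real_derivative
      L s (p' * mop (L s) n + mop (L s) (Suc n) * q')
      - W s * poly (mop (L s) (Suc n) * mop (L s) n) s) (at s)"
  proof (rule transform_deriv[OF deriv_family[OF assms has_coeff_deriv_mult[OF p' q']] assms])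
    fix u :: real assume "u > 0"
    then interpret u: jump_functional "L u" a u "W u" by (rule jump)
    show "L u (mop (L u) (Suc n) * mop (L u) n) = 0" by (rule u.mop_mop) simp
  qed
  then have "L s (p' * mop (L s) n + mop (L s) (Suc n) * q')
      - W s * poly (mop (L s) (Suc n) * mop (L s) n) s = 0"
    using DERIV_unique DERIV_const by blast
  then have "coeff p' n * mnorm (L s) n
      = W s * (poly (mop (L s) (Suc n)) s * poly (mop (L s) n) s)"
    unfolding add mult.commute[of p'] 1 2 by simp
  then have "coeff p' n = jump_r (L s) (W s) s n"
    by (simp add: jump_r_def eq_divide_eq)
  moreover have "((\<lambda>u. coeff (mop (L u) (Suc n)) n) has_real_derivative coeff p' n) (at s)"
    using p' unfolding has_coeff_deriv_def by blast
  ultimately show ?thesis by simp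
qed

lemma jump_H_deriv:
  assumes "s > 0"
  shows "((\<lambda>u. jump_H (L u) (W u) u (Suc n)) has_real_derivative jump_r (L s) (W s) s n) (at s)"
proof (rule transform_deriv[OF _ assms])
  show "((\<lambda>u. coeff (mop (L u) (Suc n)) n + (real n + 1) * (real n + 1 + a))
      has_real_derivative jump_r (L s) (W s) s n) (at s)"
    using coeff_subleading_deriv[OF assms] by (auto intro!: derivative_eq_intros)
  fix u :: real assume "u > 0"
  then interpret u: jump_functional "L u" a u "W u" by (rule jump)
  show "coeff (mop (L u) (Suc n)) n + (real n + 1) * (real n + 1 + a)
      = jump_H (L u) (W u) u (Suc n)"
    by (simp add: u.subleading)
qed

lemma rec_b_deriv:
  assumes "s > 0"
  shows "((\<lambda>u. rec_b (L u) (Suc n)) has_real_derivative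
    rec_b (L s) (Suc n) * (jump_R (L s) (W s) s n - jump_R (L s) (W s) s (Suc n))) (at s)"
proof -
  interpret jump_functional "L s" a s "W s" by (rule jump) fact
  have "((\<lambda>u. mnorm (L u) (Suc n) / mnorm (L u) n) has_real_derivative
      (- R (Suc n) * h (Suc n) * h n - h (Suc n) * (- R n * h n)) / (h n * h n)) (at s)"
    by (intro DERIV_divide mnorm_deriv assms mnorm_nonzero)
  moreover have "(- R (Suc n) * h (Suc n) * h n - h (Suc n) * (- R n * h n)) / (h n * h n)
      = rec_b (L s) (Suc n) * (R n - R (Suc n))"
    using mnorm_nonzero[of n] by (simp add: rec_b_def divide_simps) (simp add: algebra_simps)
  ultimately show ?thesis by (simp add: rec_b_def)
qed

text \<open>Solve \<open>rec_b_eq\<close> for \<open>r\<close> and apply the quotient rule; the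
  derivative of \<open>jump_H\<close> cancels the term from the denominator.\<close>

lemma jump_r_deriv:
  assumes "s > 0"
  shows "((\<lambda>u. jump_r (L u) (W u) u n) has_real_derivative
    rec_b (L s) (Suc n) * (jump_R (L s) (W s) s n - jump_R (L s) (W s) s (Suc n)) / s) (at s)"
proof (rule transform_deriv[OF _ assms])
  interpret jump_functional "L s" a s "W s" by (rule jump) fact
  let ?f = "\<lambda>u. rec_b (L u) (Suc n) - (real n + 1) * (real n + 1 + a) + jump_H (L u) (W u) u (Suc n)"
  let ?D = "rec_b (L s) (Suc n) * (R n - R (Suc n))"
  have "((\<lambda>u. ?f u / u) has_real_derivative ((?D - 0 + r n) * s - ?f s * 1) / (s * s)) (at s)"
    using assms
    by (intro DERIV_divide DERIV_add DERIV_diff DERIV_const DERIV_ident rec_b_deriv jump_H_deriv) auto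
  moreover have "((?D - 0 + r n) * s - ?f s * 1) / (s * s) = ?D / s"
    using assms unfolding rec_b_eq by (simp add: field_simps)
  ultimately show "((\<lambda>u. ?f u / u) has_real_derivative ?D / s) (at s)"
    by simp
  fix u :: real assume u: "u > 0"
  then interpret u: jump_functional "L u" a u "W u" by (rule jump)
  show "(rec_b (L u) (Suc n) - (real n + 1) * (real n + 1 + a) + jump_H (L u) (W u) u (Suc n)) / u
      = jump_r (L u) (W u) u n"
    using u by (simp add: u.rec_b_eq)
qed

end

subsection \<open>The Laguerre weight with a jump\<close>

definition lag :: "real \<Rightarrow> real poly \<Rightarrow> real \<Rightarrow> real" where
  "lag a q x = poly q x * (x powr a * exp (- x))"

lemma lag_add: "lag a (p + q) x = lag a p x + lag a q x"
  by (simp add: lag_def algebra_simps)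

lemma continuous_on_lag:
  assumes "a > 0"
  shows "continuous_on {0..} (lag a q)"
  unfolding lag_def by (intro continuous_intros continuous_on_powr') (use assms in auto)

lemma lag_monom_has_integral:
  assumes "a > 0"
  shows "(lag a (monom c k) has_integral c * Gamma (a + real k + 1)) {0..}"
proof -
  have "((\<lambda>x. x powr (a + real k) / exp x) has_integral Gamma (a + real k + 1)) {0..}"
    using Gamma_integral_real[of "a + real k + 1"] assms by simp
  then have "((\<lambda>x. c * (x powr (a + real k) / exp x)) has_integral c * Gamma (a + real k + 1)) {0..}"
    by (rule has_integral_mult_right)
  then show ?thesis
  proof (rule has_integral_eq[rotated])
    fix x :: real assume "x \<in> {0..}"
    then show "c * (x powr (a + real k) / exp x) = lag a (monom c k) x"
      using assms by (cases "x = 0")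
        (auto simp: lag_def poly_monom powr_add powr_realpow exp_minus field_simps)
  qed
qed

lemma poly_sum_monom_induct:
  assumes "\<And>c k. P (monom c k)" "\<And>p q. P p \<Longrightarrow> P q \<Longrightarrow> P (p + q)"
  shows "P (q :: real poly)"
proof -
  have "P (\<Sum>i\<in>I. monom (coeff q i) i)" if "finite I" for I
    using that
  proof (induction I)
    case empty
    then show ?case using assms(1)[of 0 0] by simp
  qed (use assms in auto)
  from this[of "{..degree q}"] show ?thesis by (simp add: poly_as_sum_of_monoms)
qed

lemma lag_integrable: "a > 0 \<Longrightarrow> lag a q integrable_on {0..}"
proof (induction q rule: poly_sum_monom_induct)
  case (1 c k)
  then show ?case using lag_monom_has_integral by blast
next
  case (2 p q)
  then show ?case using integrable_add[of "lag a p" "{0..}" "lag a q"]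
    by (simp add: lag_add[abs_def])
qed

text \<open>Multiplied by \<open>x powr a * exp (- x)\<close>, this is the derivative of
  \<open>x powr (a + 1) * exp (- x) * poly q x\<close> for \<open>x > 0\<close>.\<close>

definition pearson_op :: "real \<Rightarrow> real poly \<Rightarrow> real poly" where
  "pearson_op a q = pCons 0 (pderiv q) + smult (a + 1) q - pCons 0 q"

lemma pearson_op_add: "pearson_op a (p + q) = pearson_op a p + pearson_op a q"
  by (simp add: pearson_op_def pderiv_add smult_add_right)

lemma integral_lag_add:
  "a > 0 \<Longrightarrow> integral {0..} (lag a (p + q)) = integral {0..} (lag a p) + integral {0..} (lag a q)"
  using integral_add[OF lag_integrable lag_integrable, of a a p q]
  by (simp add: lag_add[abs_def])

text \<open>On monomials this is the functional equation of \<open>Gamma\<close>, so no boundary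
  term at infinity has to be estimated.\<close>

lemma integral_lag_pearson_op:
  assumes "a > 0"
  shows "integral {0..} (lag a (pearson_op a q)) = 0"
proof (induction q rule: poly_sum_monom_induct)
  case (1 c k)
  have "pearson_op a (monom c k) = monom (c * (a + real k + 1)) k + monom (- c) (Suc k)"
    by (cases k) (simp_all add: pearson_op_def pderiv_monom smult_monom monom_Suc[symmetric]
        add_monom algebra_simps flip: minus_monom monom_0)
  then show ?case
    using assms lag_monom_has_integral[OF assms, THEN integral_unique] Gamma_plus1[of "a + real k + 1"]
    by (simp add: integral_lag_add add_ac nonpos_Ints_def)
next
  case (2 p q)
  then show ?case using assms by (simp add: pearson_op_add integral_lag_add)
qed

lemma integral_lag_pearson_op_Icc:
  assumes "a > 0" "s > 0"
  shows "integral {0..s} (lag a (pearson_op a q)) = s * (s powr a * exp (- s)) * poly q s"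
proof -
  let ?f = "\<lambda>x. x powr (a + 1) * exp (- x) * poly q x"
  have "(lag a (pearson_op a q) has_integral (?f s - ?f 0)) {0..s}"
  proof (rule fundamental_theorem_of_calculus_interior)
    show "continuous_on {0..s} ?f"
      by (intro continuous_intros continuous_on_powr') (use assms in auto)
    fix x :: real assume "x \<in> {0<..<s}"
    then have x: "x > 0" by simp
    have "((\<lambda>x. x powr (a + 1)) has_real_derivative (a + 1) * x powr a) (at x)"
      using has_real_derivative_powr[OF x, of "a + 1"] by simp
    moreover have "((\<lambda>x. exp (- x)) has_real_derivative - exp (- x)) (at x)"
      by (auto intro!: derivative_eq_intros)
    ultimately have "(?f has_real_derivative
        ((a + 1) * x powr a * exp (- x) + - exp (- x) * x powr (a + 1)) * poly q x
        + poly (pderiv q) x * (x powr (a + 1) * exp (- x))) (at x)"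
      by (intro DERIV_mult poly_DERIV)
    then have "(?f has_real_derivative lag a (pearson_op a q) x) (at x)"
      by (rule DERIV_cong) (use x in \<open>simp add: lag_def pearson_op_def powr_add algebra_simps\<close>)
    then show "(?f has_vector_derivative lag a (pearson_op a q) x) (at x)"
      by (simp add: has_real_derivative_iff_has_vector_derivative)
  qed (use assms in auto)
  then show ?thesis using assms by (simp add: integral_unique powr_add)
qed

section \<open>The functional of the discontinuous weight\<close>

definition wfun :: "real \<Rightarrow> real \<Rightarrow> real \<Rightarrow> real \<Rightarrow> real poly \<Rightarrow> real" where
  "wfun a A B s q = integral {0..} (\<lambda>x. poly q x * lw a A B s x)"

text \<open>Written as \<open>A + B\<close> times the Laguerre weight minus \<open>B\<close> times
  its part on \<open>{0..s}\<close>, the weight depends on \<open>s\<close> only through an integral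
  over a bounded interval.\<close>

lemma wfun_has_integral:
  assumes "a > 0" "s > 0"
  shows "((\<lambda>x. poly q x * lw a A B s x) has_integral
    ((A + B) * integral {0..} (lag a q) - B * integral {0..s} (lag a q))) {0..}"
proof -
  have "lag a q integrable_on {0..s}"
    by (rule integrable_continuous_interval, rule continuous_on_subset[OF continuous_on_lag])
      (use assms in auto)
  then have "((\<lambda>x. if x \<in> {0..s} then lag a q x else 0) has_integral integral {0..s} (lag a q)) {0..}"
    by (subst has_integral_restrict) auto
  then have "((\<lambda>x. (A + B) * lag a q x - B * (if x \<in> {0..s} then lag a q x else 0)) has_integral
    ((A + B) * integral {0..} (lag a q) - B * integral {0..s} (lag a q))) {0..}"
    using lag_integrable[OF assms(1)] by (intro has_integral_diff has_integral_mult_right) auto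
  then show ?thesis
    by (rule has_integral_eq[rotated]) (auto simp: lag_def lw_def algebra_simps)
qed

lemma wfun_eq:
  assumes "a > 0" "s > 0"
  shows "wfun a A B s q = (A + B) * integral {0..} (lag a q) - B * integral {0..s} (lag a q)"
  using wfun_has_integral[OF assms] by (simp add: wfun_def integral_unique)

lemma wfun_positive_functional:
  assumes "a > 0" "A \<ge> 0" "B > 0" "s > 0"
  shows "positive_functional (wfun a A B s)"
proof
  fix p q :: "real poly" and c :: real
  note int = has_integral_integrable[OF wfun_has_integral[OF assms(1,4)]]
  show "wfun a A B s (p + q) = wfun a A B s p + wfun a A B s q"
    using integral_add[OF int int, of p A B q A B] by (simp add: wfun_def algebra_simps)
  show "wfun a A B s (smult c p) = c * wfun a A B s p"
    by (simp add: wfun_def mult.assoc)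
  assume "p \<noteq> 0"
  define g where "g = (\<lambda>x. poly (p * p) x * lw a A B s x)"
  have nonneg: "g x \<ge> 0" for x
    using assms by (simp add: g_def lw_def)
  \<comment> \<open>Since \<open>A\<close> may be 0, positivity is tested to the right of the jump,
    on an interval where the weight is continuous and positive.\<close>
  let ?J = "{s + 1..s + 2}"
  have g: "g x = (A + B) * lag a (p * p) x" if "x \<in> ?J" for x
    using that by (simp add: g_def lw_def lag_def)
  have "continuous_on ?J (\<lambda>x. (A + B) * lag a (p * p) x)"
    by (intro continuous_intros continuous_on_subset[OF continuous_on_lag]) (use assms in auto)
  then have cont: "continuous_on ?J g"
    by (rule continuous_on_eq) (simp add: g)
  have "integral ?J g \<noteq> 0"
  proof
    assume "integral ?J g = 0"
    then have "\<forall>x\<in>?J. g x = 0"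
      using integral_eq_0_iff[OF cont] nonneg by simp
    then have "?J \<subseteq> {x. poly p x = 0}"
      using g assms by (auto simp: lag_def)
    moreover have "finite {x. poly p x = 0}" using \<open>p \<noteq> 0\<close> by (rule poly_roots_finite)
    ultimately have "finite ?J" using finite_subset by blast
    then show False by (simp add: infinite_Icc)
  qed
  moreover have "integral ?J g \<ge> 0"
    by (rule integral_nonneg) (use cont nonneg in \<open>auto intro: integrable_continuous_interval\<close>)
  moreover have "integral ?J g \<le> integral {0..} g"
    by (rule integral_subset_le) (use assms cont nonneg int[of "p * p" A B] in
        \<open>auto intro: integrable_continuous_interval simp: g_def\<close>)
  ultimately show "wfun a A B s (p * p) > 0"
    by (simp add: wfun_def g_def)
qed

lemma wfun_jump_family:
  assumes "a > 0" "A \<ge> 0" "B > 0"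
  shows "jump_family (wfun a A B) (\<lambda>s. B * (s powr a * exp (- s))) a"
proof (rule jump_family.intro)
  fix s :: real assume s: "s > 0"
  interpret positive_functional "wfun a A B s"
    using assms s by (rule wfun_positive_functional)
  show "jump_functional (wfun a A B s) a s (B * (s powr a * exp (- s)))"
  proof unfold_locales
    fix q
    show "wfun a A B s (pCons 0 (pderiv q) + smult (a + 1) q - pCons 0 q)
      = - s * (B * (s powr a * exp (- s))) * poly q s"
      using wfun_eq[OF assms(1) s, of A B "pearson_op a q"] integral_lag_pearson_op[OF assms(1)]
        integral_lag_pearson_op_Icc[OF assms(1) s]
      by (simp add: pearson_op_def)
  qed
next
  fix s :: real and q assume s: "s > 0"
  \<comment> \<open>The interval extends beyond \<open>s\<close>, so that \<open>s\<close> is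
    interior and the derivative is two-sided.\<close>
  have "((\<lambda>u. integral {0..u} (lag a q)) has_real_derivative lag a q s) (at s within {0..s + 1})"
    by (rule integral_has_real_derivative, rule continuous_on_subset[OF continuous_on_lag])
      (use assms s in auto)
  then have "((\<lambda>u. integral {0..u} (lag a q)) has_real_derivative lag a q s) (at s)"
    using s by (simp add: at_within_Icc_at)
  then have "((\<lambda>u. (A + B) * integral {0..} (lag a q) - B * integral {0..u} (lag a q))
      has_real_derivative - B * lag a q s) (at s)"
    by (auto intro!: derivative_eq_intros)
  then have "((\<lambda>u. wfun a A B u q) has_real_derivative - B * lag a q s) (at s)"
    by (rule has_field_derivative_transform_within_open[of _ _ _ "{0<..}"])
      (use assms s in \<open>auto simp: wfun_eq\<close>)
  then show "((\<lambda>u. wfun a A B u q) has_real_derivative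
      - (B * (s powr a * exp (- s))) * poly q s) (at s)"
    by (simp add: lag_def mult_ac)
qed

lemma moment_eq_wfun: "moment a A B s k = wfun a A B s (monom 1 k)"
  by (simp add: moment_def wfun_def poly_monom)

subsection \<open>Hankel determinants\<close>

text \<open>Changing only the row basis to \<open>mop\<close> is a unit lower triangular operation
  \<open>C\<close>; orthogonality then makes \<open>C * M\<close> upper triangular with the norms on
  its diagonal.\<close>

lemma (in positive_functional) det_hankel:
  "det (mat n n (\<lambda>(i, j). L (monom 1 (i + j)))) = (\<Prod>j<n. mnorm L j)"
proof -
  define M where "M = mat n n (\<lambda>(i, j). L (monom 1 (i + j)))"
  define C where "C = mat n n (\<lambda>(i, k). coeff (mop L i) k)"
  define N where "N = mat n n (\<lambda>(i, j). L (mop L i * monom 1 j))"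
  have [simp]: "M \<in> carrier_mat n n" "C \<in> carrier_mat n n" "N \<in> carrier_mat n n"
    by (auto simp: M_def C_def N_def)
  have entry: "L (mop L i * monom 1 j) = (\<Sum>k<n. coeff (mop L i) k * L (monom 1 (k + j)))"
    if "i < n" for i j
  proof -
    have "degree (mop L i) \<le> i" using coeff_mop_above by (auto intro: degree_le)
    then have "mop L i = (\<Sum>k\<le>n - 1. monom (coeff (mop L i) k) k)"
      using that by (simp add: poly_as_sum_of_monoms')
    also have "{..n - 1} = {..<n}" using that by auto
    finally have "mop L i * monom 1 j
        = (\<Sum>k<n. smult (coeff (mop L i) k) (monom 1 (k + j)))"
      by (metis (no_types, lifting) mult.right_neutral mult_monom smult_monom sum.cong sum_distrib_right)
    then show ?thesis by (simp add: sum smult)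
  qed
  have "C * M = N"
    by (rule eq_matI) (auto simp: C_def M_def N_def entry scalar_prod_def atLeast0LessThan)
  then have "det N = det C * det M"
    using det_mult[of C n M] by simp
  moreover have "det C = 1"
    by (subst det_lower_triangular[of n])
      (auto simp: C_def coeff_mop_above prod_list_diag_prod)
  moreover have "upper_triangular N"
  proof (rule upper_triangularI)
    fix i j assume "j < i" "i < dim_row N"
    then have "i < n" "j < n" by (auto simp: N_def)
    moreover have "L (mop L i * monom 1 j) = 0"
      by (rule mop_orthogonal) (use \<open>j < i\<close> in auto)
    ultimately show "N $$ (i, j) = 0" by (simp add: N_def)
  qed
  then have "det N = (\<Prod>j<n. mnorm L j)"
  proof (subst det_upper_triangular[of N n])
    have "L (mop L j * monom 1 j) = mnorm L j" for j
      by (subst mop_times_leading) auto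
    then show "prod_list (diag_mat N) = (\<Prod>j<n. mnorm L j)"
      by (simp add: prod_list_diag_prod N_def atLeast0LessThan)
  qed auto
  ultimately show ?thesis by (simp add: M_def)
qed

lemma hankelD_eq_prod:
  assumes "a > 0" "A \<ge> 0" "B > 0" "s > 0"
  shows "hankelD a A B n s = (\<Prod>j<n. mnorm (wfun a A B s) j)"
proof -
  interpret positive_functional "wfun a A B s"
    using assms by (rule wfun_positive_functional)
  show ?thesis by (simp add: hankelD_def moment_eq_wfun det_hankel)
qed

lemma hankelH_eq_jump_H:
  assumes "a > 0" "A \<ge> 0" "B > 0" "s > 0"
  shows "hankelH a A B n s = jump_H (wfun a A B s) (B * (s powr a * exp (- s))) s n"
proof -
  interpret jump_family "wfun a A B" "\<lambda>s. B * (s powr a * exp (- s))" a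
    using assms(1-3) by (rule wfun_jump_family)
  interpret jump_functional "wfun a A B s" a s "B * (s powr a * exp (- s))"
    using jump[OF assms(4)] .
  have "((\<lambda>u. \<Sum>j<n. ln (mnorm (wfun a A B u) j)) has_real_derivative (\<Sum>j<n. - R j)) (at s)"
  proof (rule DERIV_sum)
    fix j
    have "((\<lambda>u. ln (mnorm (wfun a A B u) j)) has_real_derivative 1 / h j * (- R j * h j)) (at s)"
      by (rule DERIV_chain2[OF DERIV_ln_divide mnorm_deriv]) (use assms mnorm_pos in auto)
    then show "((\<lambda>u. ln (mnorm (wfun a A B u) j)) has_real_derivative - R j) (at s)"
      by simp
  qed
  then have "((\<lambda>u. ln (hankelD a A B n u)) has_real_derivative (\<Sum>j<n. - R j)) (at s)"
  proof (rule transform_deriv[OF _ assms(4)])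
    fix u :: real assume u: "u > 0"
    then interpret u: positive_functional "wfun a A B u"
      using assms by (intro wfun_positive_functional)
    show "(\<Sum>j<n. ln (mnorm (wfun a A B u) j)) = ln (hankelD a A B n u)"
      unfolding hankelD_eq_prod[OF assms(1-3) u] by (rule ln_prod[symmetric]) (auto simp: u.mnorm_pos)
  qed
  then show ?thesis
    by (simp add: hankelH_def DERIV_imp_deriv jump_H_def sum_negf)
qed

section \<open>Identification of the given data and elimination of the auxiliary quantities\<close>

theorem theorem8:
  fixes a A B t :: real and n :: nat
    and P :: "nat \<Rightarrow> real poly" and an bn :: "nat \<Rightarrow> real"
  assumes "a > 0" "A \<ge> 0" "B > 0" "t > 0" "n \<ge> 1"
    and monic: "\<And>m. degree (P m) = m \<and> lead_coeff (P m) = 1"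
    and orth: "\<And>m k. m \<noteq> k \<Longrightarrow>
                 integral {0..} (\<lambda>x. poly (P m) x * poly (P k) x * lw a A B t x) = 0"
    and recur: "\<And>m. m \<ge> 1 \<Longrightarrow>
                 [:0, 1:] * P m = P (Suc m) + Polynomial.smult (an m) (P m) + Polynomial.smult (bn m) (P (m - 1))"
  defines "H \<equiv> hankelH a A B"
  shows
    "(2 * (H n t - n * (n + a) - t * deriv (H n) t) \<noteq> 0 \<longrightarrow>
        an n - (2 * n + a + 1) =
          (t^2 * deriv (deriv (H n)) t + ((2 * n + a) * t - t^2) * deriv (H n) t + t * H n t)
          / (2 * (H n t - n * (n + a) - t * deriv (H n) t)))
     \<and> bn n - n * (n + a) = t * deriv (H n) t - H n t
     \<and> (t * deriv (deriv (H n)) t)^2 =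
          4 * (deriv (H n) t)^2 * (H n t - n * (n + a) - t * deriv (H n) t)
          + ((2 * n + a - t) * deriv (H n) t + H n t)^2
     \<and> an n - (2 * n + a + 1) = H n t - H (n + 1) t
     \<and> (t + H (n + 1) t - H (n - 1) t - 2 * n - a \<noteq> 0 \<longrightarrow>
          bn n - n * (n + a) =
            (H n t * (2 * n + a) - n * (n + a) * (H (n + 1) t - H (n - 1) t))
            / (t + H (n + 1) t - H (n - 1) t - 2 * n - a)
        \<and> (((H n t - n * (n + a)) * (t + H (n + 1) t - H (n - 1) t) + t * n * (n + a))
              / (t + H (n + 1) t - H (n - 1) t - 2 * n - a))^2 =
            (((2 * n + a) * (H n t - n * (n + a)) + t * n * (n + a))
              / (t + H (n + 1) t - H (n - 1) t - 2 * n - a))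
            * (H n t - H (n + 1) t) * (H (n - 1) t - H n t))"
proof -
  define L where "L = wfun a A B"
  define W where "W = (\<lambda>s. B * (s powr a * exp (- s)))"
  interpret jump_family L W a
    unfolding L_def W_def using assms(1-3) by (rule wfun_jump_family)
  interpret jump_functional "L t" a t "W t"
    using jump[OF \<open>t > 0\<close>] .
  obtain m where m: "n = Suc m" using \<open>n \<ge> 1\<close> by (cases n) auto
  define N where "N = real n * (real n + a)"
  define c where "c = 2 * real n + a"

  have H: "H k s = jump_H (L s) (W s) s k" if "s > 0" for k s
    unfolding H_def L_def W_def using assms(1-3) that by (rule hankelH_eq_jump_H)
  \<comment> \<open>Needed at every \<open>s > 0\<close>, not only at \<open>t\<close>, since
    \<open>deriv (H n)\<close> is differentiated again.\<close>
  have H1: "(H n has_real_derivative jump_r (L s) (W s) s m) (at s)" if "s > 0" for s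
    by (rule transform_deriv[OF jump_H_deriv[OF that] that]) (simp add: H m)
  then have dH: "deriv (H n) s = jump_r (L s) (W s) s m" if "s > 0" for s
    using that by (simp add: DERIV_imp_deriv)
  define r' where "r' = rec_b (L t) n * (R m - R n) / t"
  have "(deriv (H n) has_real_derivative r') (at t)"
    unfolding r'_def m
    by (rule transform_deriv[OF jump_r_deriv[OF \<open>t > 0\<close>] \<open>t > 0\<close>]) (simp add: dH flip: m)
  then have ddH: "deriv (deriv (H n)) t = r'"
    by (rule DERIV_imp_deriv)

  have P: "P k = mop (L t) k" for k
  proof (induction k rule: less_induct)
    case (less k)
    show ?case
    proof (rule mop_unique)
      show "coeff (P k) k = 1" using monic[of k] by metis
      show "coeff (P k) i = 0" if "i > k" for i
        using monic[of k] that by (simp add: coeff_eq_0)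
      show "L t (P k * mop (L t) i) = 0" if "i < k" for i
        using orth[of k i] that unfolding less[OF that, symmetric] by (simp add: L_def wfun_def)
    qed
  qed
  \<comment> \<open>Both recurrences now concern the same polynomials; comparing coefficients at
    \<open>n\<close> and then at \<open>m\<close> gives \<open>an n\<close> and
    \<open>bn n\<close>.\<close>
  have rec: "smult (rec_a (L t) n) (p n) + smult (rec_b (L t) n) (p m) = smult (an n) (p n) + smult (bn n) (p m)"
    using recur[OF \<open>n \<ge> 1\<close>] mop_Suc_Suc[of "L t" m] by (simp add: P m algebra_simps)
  have an: "an n = rec_a (L t) n"
    using arg_cong[OF rec, of "\<lambda>q. coeff q n"] by (simp add: m coeff_mop_above)
  have bn: "bn n = rec_b (L t) n"
    using arg_cong[OF rec, of "\<lambda>q. coeff q m"] by (simp add: an)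

  define b where "b = rec_b (L t) n"
  define h0 where "h0 = H n t"
  define r0 where "r0 = deriv (H n) t"
  define x where "x = R n"
  define y where "y = R m"
  have t: "t \<noteq> 0" using \<open>t > 0\<close> by simp
  have r0: "r0 = r m" using \<open>t > 0\<close> by (simp add: r0_def dH)
  have h0: "h0 = jump_H (L t) (W t) t n" using \<open>t > 0\<close> by (simp add: h0_def H)
  have b: "b = t * r0 + N - h0"
    using rec_b_eq[of m] by (simp add: b_def r0 h0 N_def m add.commute)
  have sum: "b * (x + y) = r0 * (t - c) - h0"
    using R_sum[of m] by (simp add: b_def r0 h0 x_def y_def c_def m algebra_simps)
  have square: "r0\<^sup>2 = b * x * y"
    using r_square[of m] by (simp add: b_def r0 x_def y_def m)
  have r': "t * r' = b * (y - x)"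
    using t by (simp add: r'_def b_def x_def y_def)
  have Hp: "H (n + 1) t = h0 - t * x"
    using \<open>t > 0\<close> by (simp add: H h0_def x_def jump_H_Suc)
  have Hm: "H (n - 1) t = h0 + t * y"
    using \<open>t > 0\<close> by (simp add: H h0_def y_def jump_H_Suc m)
  have ax: "an n - (2 * n + a + 1) = t * x"
    using rec_a_eq[of n] by (simp add: an x_def)

  have 1: "t * x = (t\<^sup>2 * r' + (c * t - t\<^sup>2) * r0 + t * h0) / (2 * (h0 - N - t * r0))"
    if "2 * (h0 - N - t * r0) \<noteq> 0"
  proof -
    \<comment> \<open>By \<open>r'\<close> and \<open>sum\<close>, the bracket on the right is
      \<open>- 2 * b * x\<close>, and \<open>- b\<close> is \<open>h0 - N - t * r0\<close>.\<close>
    have "t\<^sup>2 * r' + (c * t - t\<^sup>2) * r0 + t * h0 = t * (t * r' - (r0 * (t - c) - h0))"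
      by (simp add: algebra_simps power2_eq_square)
    also have "\<dots> = t * x * (2 * (h0 - N - t * r0))"
      unfolding r' sum[symmetric] b by (simp add: algebra_simps)
    finally show ?thesis using that by simp
  qed
  have 2: "(t * r')\<^sup>2 = 4 * r0\<^sup>2 * (h0 - N - t * r0) + ((c - t) * r0 + h0)\<^sup>2"
  proof -
    \<comment> \<open>The square of a difference in terms of sum and product, which are known from
      \<open>sum\<close> and \<open>square\<close>.\<close>
    have "(t * r')\<^sup>2 = (b * (x + y))\<^sup>2 - 4 * b * (b * x * y)"
      unfolding r' by (simp add: algebra_simps power2_eq_square)
    also have "\<dots> = (r0 * (t - c) - h0)\<^sup>2 - 4 * b * r0\<^sup>2"
      by (simp only: sum square)
    finally show ?thesis
      unfolding b by (simp add: algebra_simps power2_eq_square)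
  qed
  \<comment> \<open>The common denominator of the difference formulas. Multiplying it by
    \<open>b\<close> lets \<open>sum\<close> remove \<open>x + y\<close>, and then \<open>b\<close>
    removes \<open>r0\<close>.\<close>
  define d where "d = t - t * x - t * y - c"
  have bd: "b * d = h0 * c - N * c + N * t"
  proof -
    have "b * d = b * (t - c) - t * (b * (x + y))"
      by (simp add: d_def algebra_simps)
    also have "\<dots> = (b - t * r0) * (t - c) + t * h0"
      unfolding sum by (simp add: algebra_simps)
    finally show ?thesis by (simp add: b algebra_simps)
  qed
  have tr: "t * r0 = b - N + h0" by (simp add: b)
  have 3: "b - N = (h0 * c - N * (- t * x - t * y)) / d" if "d \<noteq> 0"
  proof -
    have "(b - N) * d = h0 * c - N * (- t * x - t * y)"
      using bd by (simp add: left_diff_distrib) (simp add: d_def algebra_simps)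
    then show ?thesis using that by (simp add: eq_divide_eq)
  qed
  have 4: "(((h0 - N) * (t - t * x - t * y) + t * N) / d)\<^sup>2
      = ((c * (h0 - N) + t * N) / d) * (t * x) * (t * y)" if "d \<noteq> 0"
  proof -
    have "(t * r0) * d = (h0 - N) * (t - t * x - t * y) + t * N"
      using bd unfolding tr by (simp add: algebra_simps) (simp add: d_def algebra_simps)
    then have "((h0 - N) * (t - t * x - t * y) + t * N) / d = t * r0"
      using that by (simp add: divide_eq_eq)
    moreover have "(c * (h0 - N) + t * N) / d = b"
      using bd that by (simp add: divide_eq_eq algebra_simps)
    moreover have "(t * r0)\<^sup>2 = b * (t * x) * (t * y)"
      using square by (simp add: power2_eq_square algebra_simps)
    ultimately show ?thesis by simp
  qed
  have d': "t + H (n + 1) t - H (n - 1) t - 2 * n - a = d"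
    "t + H (n + 1) t - H (n - 1) t = t - t * x - t * y"
    "H (n + 1) t - H (n - 1) t = - t * x - t * y"
    "H n t - H (n + 1) t = t * x" "H (n - 1) t - H n t = t * y"
    unfolding Hp Hm d_def c_def by (simp_all add: h0_def)
  have c': "2 * n + a = c" "n * (n + a) = N" "t * n * (n + a) = t * N" "H n t = h0"
    "deriv (H n) t = r0"
    by (simp_all add: c_def N_def h0_def r0_def mult.assoc)
  show ?thesis
    \<comment> \<open>The left side of \<open>d'(2)\<close> is a subterm of that of
      \<open>d'(1)\<close>, and \<open>H n t\<close> occurs in \<open>d'(4)\<close> and
      \<open>d'(5)\<close>, so larger patterns are rewritten first.\<close>
    unfolding ax bn ddH b_def[symmetric]
    unfolding d'(1)
    unfolding d'(2)
    unfolding d'(3-5)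
    unfolding c'
    using 1 2 3 4 tr by (intro conjI impI) auto
qed

end
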